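(* Let $A:\mathcal{U}$ and $B:A\to\mathcal{U}$ be such that the W-type $W:\equiv W_{x:A}B(x)$ is of finite arity, let $comp:W\to\mathbb{N}$ be the complexity function, and for $n:\mathbb{N}$ let $C(n)$ be the type of terms $w:W$ with $comp(w)=n$. Let $P:W\to\mathcal{U}$ be a dependent type such that there exist 1. $\alpha:\prod_{w:C(0)}P(w)$, and 2. $\beta:\prod_{n:\mathbb{N}}\left(\prod_{w:C(n)}P(w)\to\prod_{w:C(n+1)}P(w)\right)$. Then there exists $\gamma:\prod_{w:W}P(w)$.
   Context: The setting is Martin-Löf dependent type theory with a universe $\mathcal{U}$ of types. For $A:\mathcal{U}$ and $B:A\to\mathcal{U}$, the W-type $W_{x:A}B(x)$ is the type of well-founded trees with constructor $sup(a,f):W_{x:A}B(x)$ for $a:A$ and $f:B(a)\to W_{x:A}B(x)$, with the usual elimination (induction) and computation rules. The projections are $pr_1(sup(a,f))\equiv a$ and $pr_2(sup(a,f))\equiv f$. A term $w$ is minimal, $isMin(w)$, if $\neg B(pr_1(w))$, i.e. $B(pr_1(w))$ is empty. The W-type is of finite arity if for each $w$ there is a natural number $n$ such that $B(pr_1(w))$ has exactly $n$ different terms. For a W-type of finite arity, the complexity function $comp:W_{x:A}B(x)\to\mathbb{N}$ is given by: $comp(w)=0$ if $isMin(w)$; and $comp(w)=\max\{comp(pr_2(w)(b))\mid b:B(pr_1(w))\}+1$ if $\neg isMin(w)$. *)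

theory Defs
  imports Main
begin

text \<open>
  Intensional Martin-Loef type theory with dependent functions and pairs, sums, the empty type,
  the unit type, natural numbers, identity types, W-types and a cumulative hierarchy of
  Russell-style universes, in the style of the second formal presentation in the appendix of the
  book ``Homotopy Type Theory'' (without univalence and function extensionality).  An arbitrary
  universe of the hierarchy plays the role of the ambient universe of types.

  Variables are de Bruijn indices.  An eliminator lists its motive (under one binder, or three for
  \<open>IndId\<close>), its branches (under as many binders as the branch has arguments, induction hypotheses
  last) and then its main argument.
\<close>

datatype tm =
    Var nat
  | Univ nat
  | Pi tm tm | Lam tm tm | App tm tm
  | Sig tm tm | Pr tm tm | IndSig tm tm tm
  | Plus tm tm | Inj1 tm | Inj2 tm | IndPlus tm tm tm tm
  | Empty | IndEmpty tm tm
  | Unit | Star | IndUnit tm tm tm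
  | Nat | Zero | Succ tm | IndNat tm tm tm tm
  | Idt tm tm tm | Rfl tm | IndId tm tm tm tm tm
  | W tm tm | Node tm tm | IndW tm tm tm


section \<open>Renaming and substitution\<close>

definition lift_ren :: "(nat \<Rightarrow> nat) \<Rightarrow> nat \<Rightarrow> nat" where
  "lift_ren \<rho> = case_nat 0 (\<lambda>i. Suc (\<rho> i))"

primrec ren :: "(nat \<Rightarrow> nat) \<Rightarrow> tm \<Rightarrow> tm" where
  "ren \<rho> (Var i) = Var (\<rho> i)"
| "ren \<rho> (Univ k) = Univ k"
| "ren \<rho> (Pi A B) = Pi (ren \<rho> A) (ren (lift_ren \<rho>) B)"
| "ren \<rho> (Lam A b) = Lam (ren \<rho> A) (ren (lift_ren \<rho>) b)"
| "ren \<rho> (App f a) = App (ren \<rho> f) (ren \<rho> a)"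
| "ren \<rho> (Sig A B) = Sig (ren \<rho> A) (ren (lift_ren \<rho>) B)"
| "ren \<rho> (Pr a b) = Pr (ren \<rho> a) (ren \<rho> b)"
| "ren \<rho> (IndSig C g p) =
     IndSig (ren (lift_ren \<rho>) C) (ren (lift_ren (lift_ren \<rho>)) g) (ren \<rho> p)"
| "ren \<rho> (Plus A B) = Plus (ren \<rho> A) (ren \<rho> B)"
| "ren \<rho> (Inj1 a) = Inj1 (ren \<rho> a)"
| "ren \<rho> (Inj2 b) = Inj2 (ren \<rho> b)"
| "ren \<rho> (IndPlus C c d p) =
     IndPlus (ren (lift_ren \<rho>) C) (ren (lift_ren \<rho>) c) (ren (lift_ren \<rho>) d) (ren \<rho> p)"
| "ren \<rho> Empty = Empty"
| "ren \<rho> (IndEmpty C p) = IndEmpty (ren (lift_ren \<rho>) C) (ren \<rho> p)"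
| "ren \<rho> Unit = Unit"
| "ren \<rho> Star = Star"
| "ren \<rho> (IndUnit C c p) = IndUnit (ren (lift_ren \<rho>) C) (ren \<rho> c) (ren \<rho> p)"
| "ren \<rho> Nat = Nat"
| "ren \<rho> Zero = Zero"
| "ren \<rho> (Succ n) = Succ (ren \<rho> n)"
| "ren \<rho> (IndNat C c d n) =
     IndNat (ren (lift_ren \<rho>) C) (ren \<rho> c) (ren (lift_ren (lift_ren \<rho>)) d) (ren \<rho> n)"
| "ren \<rho> (Idt A a b) = Idt (ren \<rho> A) (ren \<rho> a) (ren \<rho> b)"
| "ren \<rho> (Rfl a) = Rfl (ren \<rho> a)"
| "ren \<rho> (IndId C c a b p) =
     IndId (ren (lift_ren (lift_ren (lift_ren \<rho>))) C) (ren (lift_ren \<rho>) c)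
       (ren \<rho> a) (ren \<rho> b) (ren \<rho> p)"
| "ren \<rho> (W A B) = W (ren \<rho> A) (ren (lift_ren \<rho>) B)"
| "ren \<rho> (Node a f) = Node (ren \<rho> a) (ren \<rho> f)"
| "ren \<rho> (IndW C d w) =
     IndW (ren (lift_ren \<rho>) C) (ren (lift_ren (lift_ren (lift_ren \<rho>))) d) (ren \<rho> w)"

definition shift :: "nat \<Rightarrow> tm \<Rightarrow> tm" where
  "shift k = ren (\<lambda>i. i + k)"

definition scons :: "tm \<Rightarrow> (nat \<Rightarrow> tm) \<Rightarrow> nat \<Rightarrow> tm"  (infixr "\<cdot>" 65) where
  "a \<cdot> \<sigma> = case_nat a \<sigma>"

definition up :: "nat \<Rightarrow> nat \<Rightarrow> tm" where
  "up k = (\<lambda>i. Var (i + k))"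

definition lift_sub :: "(nat \<Rightarrow> tm) \<Rightarrow> nat \<Rightarrow> tm" where
  "lift_sub \<sigma> = Var 0 \<cdot> (\<lambda>i. shift 1 (\<sigma> i))"

primrec sub :: "(nat \<Rightarrow> tm) \<Rightarrow> tm \<Rightarrow> tm" where
  "sub \<sigma> (Var i) = \<sigma> i"
| "sub \<sigma> (Univ k) = Univ k"
| "sub \<sigma> (Pi A B) = Pi (sub \<sigma> A) (sub (lift_sub \<sigma>) B)"
| "sub \<sigma> (Lam A b) = Lam (sub \<sigma> A) (sub (lift_sub \<sigma>) b)"
| "sub \<sigma> (App f a) = App (sub \<sigma> f) (sub \<sigma> a)"
| "sub \<sigma> (Sig A B) = Sig (sub \<sigma> A) (sub (lift_sub \<sigma>) B)"
| "sub \<sigma> (Pr a b) = Pr (sub \<sigma> a) (sub \<sigma> b)"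
| "sub \<sigma> (IndSig C g p) =
     IndSig (sub (lift_sub \<sigma>) C) (sub (lift_sub (lift_sub \<sigma>)) g) (sub \<sigma> p)"
| "sub \<sigma> (Plus A B) = Plus (sub \<sigma> A) (sub \<sigma> B)"
| "sub \<sigma> (Inj1 a) = Inj1 (sub \<sigma> a)"
| "sub \<sigma> (Inj2 b) = Inj2 (sub \<sigma> b)"
| "sub \<sigma> (IndPlus C c d p) =
     IndPlus (sub (lift_sub \<sigma>) C) (sub (lift_sub \<sigma>) c) (sub (lift_sub \<sigma>) d) (sub \<sigma> p)"
| "sub \<sigma> Empty = Empty"
| "sub \<sigma> (IndEmpty C p) = IndEmpty (sub (lift_sub \<sigma>) C) (sub \<sigma> p)"
| "sub \<sigma> Unit = Unit"
| "sub \<sigma> Star = Star"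
| "sub \<sigma> (IndUnit C c p) = IndUnit (sub (lift_sub \<sigma>) C) (sub \<sigma> c) (sub \<sigma> p)"
| "sub \<sigma> Nat = Nat"
| "sub \<sigma> Zero = Zero"
| "sub \<sigma> (Succ n) = Succ (sub \<sigma> n)"
| "sub \<sigma> (IndNat C c d n) =
     IndNat (sub (lift_sub \<sigma>) C) (sub \<sigma> c) (sub (lift_sub (lift_sub \<sigma>)) d) (sub \<sigma> n)"
| "sub \<sigma> (Idt A a b) = Idt (sub \<sigma> A) (sub \<sigma> a) (sub \<sigma> b)"
| "sub \<sigma> (Rfl a) = Rfl (sub \<sigma> a)"
| "sub \<sigma> (IndId C c a b p) =
     IndId (sub (lift_sub (lift_sub (lift_sub \<sigma>))) C) (sub (lift_sub \<sigma>) c)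
       (sub \<sigma> a) (sub \<sigma> b) (sub \<sigma> p)"
| "sub \<sigma> (W A B) = W (sub \<sigma> A) (sub (lift_sub \<sigma>) B)"
| "sub \<sigma> (Node a f) = Node (sub \<sigma> a) (sub \<sigma> f)"
| "sub \<sigma> (IndW C d w) =
     IndW (sub (lift_sub \<sigma>) C) (sub (lift_sub (lift_sub (lift_sub \<sigma>))) d) (sub \<sigma> w)"

abbreviation inst :: "tm \<Rightarrow> tm \<Rightarrow> tm"  ("_\<langle>_\<rangle>" [1000, 0] 1000) where
  "t\<langle>a\<rangle> \<equiv> sub (a \<cdot> Var) t"


section \<open>Judgements\<close>

text \<open>
  A context lists its types innermost first; the type at position \<open>i\<close> lives in the remaining,
  outer part of the context.  A type is a term of some universe.  Some rules repeat premises that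
  are presuppositions of their other premises.
\<close>

inductive
  wf_ctx :: "tm list \<Rightarrow> bool"  ("\<turnstile> _" [51] 50) and
  typing :: "tm list \<Rightarrow> tm \<Rightarrow> tm \<Rightarrow> bool"  ("_ \<turnstile> _ : _" [51, 51, 51] 50) and
  jeq :: "tm list \<Rightarrow> tm \<Rightarrow> tm \<Rightarrow> tm \<Rightarrow> bool"  ("_ \<turnstile> _ \<doteq> _ : _" [51, 51, 51, 51] 50)
where
  ctx_empty: "\<turnstile> []"
| ctx_ext: "\<lbrakk>\<turnstile> \<Gamma>; \<Gamma> \<turnstile> A : Univ i\<rbrakk> \<Longrightarrow> \<turnstile> A # \<Gamma>"

| var: "\<lbrakk>\<turnstile> \<Gamma>; k < length \<Gamma>\<rbrakk> \<Longrightarrow> \<Gamma> \<turnstile> Var k : shift (Suc k) (\<Gamma> ! k)"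

| univ: "\<turnstile> \<Gamma> \<Longrightarrow> \<Gamma> \<turnstile> Univ i : Univ (Suc i)"
| cumul: "\<Gamma> \<turnstile> A : Univ i \<Longrightarrow> \<Gamma> \<turnstile> A : Univ (Suc i)"
| cumul_eq: "\<Gamma> \<turnstile> A \<doteq> B : Univ i \<Longrightarrow> \<Gamma> \<turnstile> A \<doteq> B : Univ (Suc i)"

| conv: "\<lbrakk>\<Gamma> \<turnstile> a : A; \<Gamma> \<turnstile> A \<doteq> B : Univ i\<rbrakk> \<Longrightarrow> \<Gamma> \<turnstile> a : B"
| conv_eq: "\<lbrakk>\<Gamma> \<turnstile> a \<doteq> b : A; \<Gamma> \<turnstile> A \<doteq> B : Univ i\<rbrakk> \<Longrightarrow> \<Gamma> \<turnstile> a \<doteq> b : B"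
| eq_refl: "\<Gamma> \<turnstile> a : A \<Longrightarrow> \<Gamma> \<turnstile> a \<doteq> a : A"
| eq_sym: "\<Gamma> \<turnstile> a \<doteq> b : A \<Longrightarrow> \<Gamma> \<turnstile> b \<doteq> a : A"
| eq_trans: "\<lbrakk>\<Gamma> \<turnstile> a \<doteq> b : A; \<Gamma> \<turnstile> b \<doteq> c : A\<rbrakk> \<Longrightarrow> \<Gamma> \<turnstile> a \<doteq> c : A"

| Pi_form: "\<lbrakk>\<Gamma> \<turnstile> A : Univ i; A # \<Gamma> \<turnstile> B : Univ i\<rbrakk> \<Longrightarrow> \<Gamma> \<turnstile> Pi A B : Univ i"
| Pi_intro: "\<lbrakk>\<Gamma> \<turnstile> A : Univ i; A # \<Gamma> \<turnstile> b : B\<rbrakk> \<Longrightarrow> \<Gamma> \<turnstile> Lam A b : Pi A B"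
| Pi_elim: "\<lbrakk>\<Gamma> \<turnstile> f : Pi A B; \<Gamma> \<turnstile> a : A\<rbrakk> \<Longrightarrow> \<Gamma> \<turnstile> App f a : B\<langle>a\<rangle>"
| Pi_comp: "\<lbrakk>\<Gamma> \<turnstile> A : Univ i; A # \<Gamma> \<turnstile> b : B; \<Gamma> \<turnstile> a : A\<rbrakk> \<Longrightarrow>
    \<Gamma> \<turnstile> App (Lam A b) a \<doteq> b\<langle>a\<rangle> : B\<langle>a\<rangle>"
| Pi_uniq: "\<Gamma> \<turnstile> f : Pi A B \<Longrightarrow> \<Gamma> \<turnstile> f \<doteq> Lam A (App (shift 1 f) (Var 0)) : Pi A B"

| Sig_form: "\<lbrakk>\<Gamma> \<turnstile> A : Univ i; A # \<Gamma> \<turnstile> B : Univ i\<rbrakk> \<Longrightarrow> \<Gamma> \<turnstile> Sig A B : Univ i"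
| Sig_intro: "\<lbrakk>\<Gamma> \<turnstile> A : Univ i; A # \<Gamma> \<turnstile> B : Univ i; \<Gamma> \<turnstile> a : A; \<Gamma> \<turnstile> b : B\<langle>a\<rangle>\<rbrakk> \<Longrightarrow>
    \<Gamma> \<turnstile> Pr a b : Sig A B"
| Sig_elim: "\<lbrakk>\<Gamma> \<turnstile> A : Univ i; A # \<Gamma> \<turnstile> B : Univ i; Sig A B # \<Gamma> \<turnstile> C : Univ j;
    B # A # \<Gamma> \<turnstile> g : sub (Pr (Var 1) (Var 0) \<cdot> up 2) C; \<Gamma> \<turnstile> p : Sig A B\<rbrakk> \<Longrightarrow>
    \<Gamma> \<turnstile> IndSig C g p : C\<langle>p\<rangle>"
| Sig_comp: "\<lbrakk>\<Gamma> \<turnstile> A : Univ i; A # \<Gamma> \<turnstile> B : Univ i; Sig A B # \<Gamma> \<turnstile> C : Univ j;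
    B # A # \<Gamma> \<turnstile> g : sub (Pr (Var 1) (Var 0) \<cdot> up 2) C; \<Gamma> \<turnstile> a : A; \<Gamma> \<turnstile> b : B\<langle>a\<rangle>\<rbrakk> \<Longrightarrow>
    \<Gamma> \<turnstile> IndSig C g (Pr a b) \<doteq> sub (b \<cdot> a \<cdot> Var) g : C\<langle>Pr a b\<rangle>"

| Plus_form: "\<lbrakk>\<Gamma> \<turnstile> A : Univ i; \<Gamma> \<turnstile> B : Univ i\<rbrakk> \<Longrightarrow> \<Gamma> \<turnstile> Plus A B : Univ i"
| Plus_intro1: "\<lbrakk>\<Gamma> \<turnstile> A : Univ i; \<Gamma> \<turnstile> B : Univ i; \<Gamma> \<turnstile> a : A\<rbrakk> \<Longrightarrow> \<Gamma> \<turnstile> Inj1 a : Plus A B"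
| Plus_intro2: "\<lbrakk>\<Gamma> \<turnstile> A : Univ i; \<Gamma> \<turnstile> B : Univ i; \<Gamma> \<turnstile> b : B\<rbrakk> \<Longrightarrow> \<Gamma> \<turnstile> Inj2 b : Plus A B"
| Plus_elim: "\<lbrakk>\<Gamma> \<turnstile> A : Univ i; \<Gamma> \<turnstile> B : Univ i; Plus A B # \<Gamma> \<turnstile> C : Univ j;
    A # \<Gamma> \<turnstile> c : sub (Inj1 (Var 0) \<cdot> up 1) C; B # \<Gamma> \<turnstile> d : sub (Inj2 (Var 0) \<cdot> up 1) C;
    \<Gamma> \<turnstile> p : Plus A B\<rbrakk> \<Longrightarrow> \<Gamma> \<turnstile> IndPlus C c d p : C\<langle>p\<rangle>"
| Plus_comp1: "\<lbrakk>\<Gamma> \<turnstile> A : Univ i; \<Gamma> \<turnstile> B : Univ i; Plus A B # \<Gamma> \<turnstile> C : Univ j;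
    A # \<Gamma> \<turnstile> c : sub (Inj1 (Var 0) \<cdot> up 1) C; B # \<Gamma> \<turnstile> d : sub (Inj2 (Var 0) \<cdot> up 1) C;
    \<Gamma> \<turnstile> a : A\<rbrakk> \<Longrightarrow> \<Gamma> \<turnstile> IndPlus C c d (Inj1 a) \<doteq> c\<langle>a\<rangle> : C\<langle>Inj1 a\<rangle>"
| Plus_comp2: "\<lbrakk>\<Gamma> \<turnstile> A : Univ i; \<Gamma> \<turnstile> B : Univ i; Plus A B # \<Gamma> \<turnstile> C : Univ j;
    A # \<Gamma> \<turnstile> c : sub (Inj1 (Var 0) \<cdot> up 1) C; B # \<Gamma> \<turnstile> d : sub (Inj2 (Var 0) \<cdot> up 1) C;
    \<Gamma> \<turnstile> b : B\<rbrakk> \<Longrightarrow> \<Gamma> \<turnstile> IndPlus C c d (Inj2 b) \<doteq> d\<langle>b\<rangle> : C\<langle>Inj2 b\<rangle>"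

| Empty_form: "\<turnstile> \<Gamma> \<Longrightarrow> \<Gamma> \<turnstile> Empty : Univ i"
| Empty_elim: "\<lbrakk>Empty # \<Gamma> \<turnstile> C : Univ i; \<Gamma> \<turnstile> p : Empty\<rbrakk> \<Longrightarrow> \<Gamma> \<turnstile> IndEmpty C p : C\<langle>p\<rangle>"

| Unit_form: "\<turnstile> \<Gamma> \<Longrightarrow> \<Gamma> \<turnstile> Unit : Univ i"
| Unit_intro: "\<turnstile> \<Gamma> \<Longrightarrow> \<Gamma> \<turnstile> Star : Unit"
| Unit_elim: "\<lbrakk>Unit # \<Gamma> \<turnstile> C : Univ i; \<Gamma> \<turnstile> c : C\<langle>Star\<rangle>; \<Gamma> \<turnstile> p : Unit\<rbrakk> \<Longrightarrow>
    \<Gamma> \<turnstile> IndUnit C c p : C\<langle>p\<rangle>"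
| Unit_comp: "\<lbrakk>Unit # \<Gamma> \<turnstile> C : Univ i; \<Gamma> \<turnstile> c : C\<langle>Star\<rangle>\<rbrakk> \<Longrightarrow>
    \<Gamma> \<turnstile> IndUnit C c Star \<doteq> c : C\<langle>Star\<rangle>"

| Nat_form: "\<turnstile> \<Gamma> \<Longrightarrow> \<Gamma> \<turnstile> Nat : Univ i"
| Nat_intro1: "\<turnstile> \<Gamma> \<Longrightarrow> \<Gamma> \<turnstile> Zero : Nat"
| Nat_intro2: "\<Gamma> \<turnstile> n : Nat \<Longrightarrow> \<Gamma> \<turnstile> Succ n : Nat"
| Nat_elim: "\<lbrakk>Nat # \<Gamma> \<turnstile> C : Univ i; \<Gamma> \<turnstile> c : C\<langle>Zero\<rangle>;
    C # Nat # \<Gamma> \<turnstile> d : sub (Succ (Var 1) \<cdot> up 2) C; \<Gamma> \<turnstile> n : Nat\<rbrakk> \<Longrightarrow>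
    \<Gamma> \<turnstile> IndNat C c d n : C\<langle>n\<rangle>"
| Nat_comp1: "\<lbrakk>Nat # \<Gamma> \<turnstile> C : Univ i; \<Gamma> \<turnstile> c : C\<langle>Zero\<rangle>;
    C # Nat # \<Gamma> \<turnstile> d : sub (Succ (Var 1) \<cdot> up 2) C\<rbrakk> \<Longrightarrow>
    \<Gamma> \<turnstile> IndNat C c d Zero \<doteq> c : C\<langle>Zero\<rangle>"
| Nat_comp2: "\<lbrakk>Nat # \<Gamma> \<turnstile> C : Univ i; \<Gamma> \<turnstile> c : C\<langle>Zero\<rangle>;
    C # Nat # \<Gamma> \<turnstile> d : sub (Succ (Var 1) \<cdot> up 2) C; \<Gamma> \<turnstile> n : Nat\<rbrakk> \<Longrightarrow>
    \<Gamma> \<turnstile> IndNat C c d (Succ n) \<doteq> sub (IndNat C c d n \<cdot> n \<cdot> Var) d : C\<langle>Succ n\<rangle>"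

| Id_form: "\<lbrakk>\<Gamma> \<turnstile> A : Univ i; \<Gamma> \<turnstile> a : A; \<Gamma> \<turnstile> b : A\<rbrakk> \<Longrightarrow> \<Gamma> \<turnstile> Idt A a b : Univ i"
| Id_intro: "\<lbrakk>\<Gamma> \<turnstile> A : Univ i; \<Gamma> \<turnstile> a : A\<rbrakk> \<Longrightarrow> \<Gamma> \<turnstile> Rfl a : Idt A a a"
| Id_elim: "\<lbrakk>\<Gamma> \<turnstile> A : Univ i;
    Idt (shift 2 A) (Var 1) (Var 0) # shift 1 A # A # \<Gamma> \<turnstile> C : Univ j;
    A # \<Gamma> \<turnstile> c : sub (Rfl (Var 0) \<cdot> Var 0 \<cdot> Var 0 \<cdot> up 1) C;
    \<Gamma> \<turnstile> a : A; \<Gamma> \<turnstile> b : A; \<Gamma> \<turnstile> p : Idt A a b\<rbrakk> \<Longrightarrow>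
    \<Gamma> \<turnstile> IndId C c a b p : sub (p \<cdot> b \<cdot> a \<cdot> Var) C"
| Id_comp: "\<lbrakk>\<Gamma> \<turnstile> A : Univ i;
    Idt (shift 2 A) (Var 1) (Var 0) # shift 1 A # A # \<Gamma> \<turnstile> C : Univ j;
    A # \<Gamma> \<turnstile> c : sub (Rfl (Var 0) \<cdot> Var 0 \<cdot> Var 0 \<cdot> up 1) C; \<Gamma> \<turnstile> a : A\<rbrakk> \<Longrightarrow>
    \<Gamma> \<turnstile> IndId C c a a (Rfl a) \<doteq> c\<langle>a\<rangle> : sub (Rfl a \<cdot> a \<cdot> a \<cdot> Var) C"

| W_form: "\<lbrakk>\<Gamma> \<turnstile> A : Univ i; A # \<Gamma> \<turnstile> B : Univ i\<rbrakk> \<Longrightarrow> \<Gamma> \<turnstile> W A B : Univ i"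
| W_intro: "\<lbrakk>\<Gamma> \<turnstile> A : Univ i; A # \<Gamma> \<turnstile> B : Univ i; \<Gamma> \<turnstile> a : A; \<Gamma> \<turnstile> f : Pi (B\<langle>a\<rangle>) (shift 1 (W A B))\<rbrakk> \<Longrightarrow>
    \<Gamma> \<turnstile> Node a f : W A B"
| W_elim: "\<lbrakk>\<Gamma> \<turnstile> A : Univ i; A # \<Gamma> \<turnstile> B : Univ i; W A B # \<Gamma> \<turnstile> C : Univ j;
    Pi (shift 1 B) (sub (App (Var 1) (Var 0) \<cdot> up 3) C) # Pi B (shift 2 (W A B)) # A # \<Gamma> \<turnstile>
      d : sub (Node (Var 2) (Var 1) \<cdot> up 3) C;
    \<Gamma> \<turnstile> w : W A B\<rbrakk> \<Longrightarrow> \<Gamma> \<turnstile> IndW C d w : C\<langle>w\<rangle>"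
| W_comp: "\<lbrakk>\<Gamma> \<turnstile> A : Univ i; A # \<Gamma> \<turnstile> B : Univ i; W A B # \<Gamma> \<turnstile> C : Univ j;
    Pi (shift 1 B) (sub (App (Var 1) (Var 0) \<cdot> up 3) C) # Pi B (shift 2 (W A B)) # A # \<Gamma> \<turnstile>
      d : sub (Node (Var 2) (Var 1) \<cdot> up 3) C;
    \<Gamma> \<turnstile> a : A; \<Gamma> \<turnstile> f : Pi (B\<langle>a\<rangle>) (shift 1 (W A B))\<rbrakk> \<Longrightarrow>
    \<Gamma> \<turnstile> IndW C d (Node a f) \<doteq>
      sub (Lam (B\<langle>a\<rangle>) (IndW (ren (lift_ren Suc) C) (ren (lift_ren (lift_ren (lift_ren Suc))) d)
             (App (shift 1 f) (Var 0))) \<cdot> f \<cdot> a \<cdot> Var) d : C\<langle>Node a f\<rangle>"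

| Pi_cong: "\<lbrakk>\<Gamma> \<turnstile> A : Univ i; \<Gamma> \<turnstile> A \<doteq> A' : Univ i; A # \<Gamma> \<turnstile> B \<doteq> B' : Univ i\<rbrakk> \<Longrightarrow>
    \<Gamma> \<turnstile> Pi A B \<doteq> Pi A' B' : Univ i"
| Lam_cong: "\<lbrakk>\<Gamma> \<turnstile> A : Univ i; \<Gamma> \<turnstile> A \<doteq> A' : Univ i; A # \<Gamma> \<turnstile> b \<doteq> b' : B\<rbrakk> \<Longrightarrow>
    \<Gamma> \<turnstile> Lam A b \<doteq> Lam A' b' : Pi A B"
| App_cong: "\<lbrakk>\<Gamma> \<turnstile> f \<doteq> f' : Pi A B; \<Gamma> \<turnstile> a \<doteq> a' : A\<rbrakk> \<Longrightarrow> \<Gamma> \<turnstile> App f a \<doteq> App f' a' : B\<langle>a\<rangle>"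
| Sig_cong: "\<lbrakk>\<Gamma> \<turnstile> A : Univ i; \<Gamma> \<turnstile> A \<doteq> A' : Univ i; A # \<Gamma> \<turnstile> B \<doteq> B' : Univ i\<rbrakk> \<Longrightarrow>
    \<Gamma> \<turnstile> Sig A B \<doteq> Sig A' B' : Univ i"
| Pr_cong: "\<lbrakk>\<Gamma> \<turnstile> A : Univ i; A # \<Gamma> \<turnstile> B : Univ i; \<Gamma> \<turnstile> a \<doteq> a' : A; \<Gamma> \<turnstile> b \<doteq> b' : B\<langle>a\<rangle>\<rbrakk> \<Longrightarrow>
    \<Gamma> \<turnstile> Pr a b \<doteq> Pr a' b' : Sig A B"
| IndSig_cong: "\<lbrakk>\<Gamma> \<turnstile> A : Univ i; A # \<Gamma> \<turnstile> B : Univ i; Sig A B # \<Gamma> \<turnstile> C \<doteq> C' : Univ j;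
    B # A # \<Gamma> \<turnstile> g \<doteq> g' : sub (Pr (Var 1) (Var 0) \<cdot> up 2) C; \<Gamma> \<turnstile> p \<doteq> p' : Sig A B\<rbrakk> \<Longrightarrow>
    \<Gamma> \<turnstile> IndSig C g p \<doteq> IndSig C' g' p' : C\<langle>p\<rangle>"
| Plus_cong: "\<lbrakk>\<Gamma> \<turnstile> A \<doteq> A' : Univ i; \<Gamma> \<turnstile> B \<doteq> B' : Univ i\<rbrakk> \<Longrightarrow>
    \<Gamma> \<turnstile> Plus A B \<doteq> Plus A' B' : Univ i"
| Inj1_cong: "\<lbrakk>\<Gamma> \<turnstile> A : Univ i; \<Gamma> \<turnstile> B : Univ i; \<Gamma> \<turnstile> a \<doteq> a' : A\<rbrakk> \<Longrightarrow>
    \<Gamma> \<turnstile> Inj1 a \<doteq> Inj1 a' : Plus A B"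
| Inj2_cong: "\<lbrakk>\<Gamma> \<turnstile> A : Univ i; \<Gamma> \<turnstile> B : Univ i; \<Gamma> \<turnstile> b \<doteq> b' : B\<rbrakk> \<Longrightarrow>
    \<Gamma> \<turnstile> Inj2 b \<doteq> Inj2 b' : Plus A B"
| IndPlus_cong: "\<lbrakk>\<Gamma> \<turnstile> A : Univ i; \<Gamma> \<turnstile> B : Univ i; Plus A B # \<Gamma> \<turnstile> C \<doteq> C' : Univ j;
    A # \<Gamma> \<turnstile> c \<doteq> c' : sub (Inj1 (Var 0) \<cdot> up 1) C; B # \<Gamma> \<turnstile> d \<doteq> d' : sub (Inj2 (Var 0) \<cdot> up 1) C;
    \<Gamma> \<turnstile> p \<doteq> p' : Plus A B\<rbrakk> \<Longrightarrow> \<Gamma> \<turnstile> IndPlus C c d p \<doteq> IndPlus C' c' d' p' : C\<langle>p\<rangle>"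
| IndEmpty_cong: "\<lbrakk>Empty # \<Gamma> \<turnstile> C \<doteq> C' : Univ i; \<Gamma> \<turnstile> p \<doteq> p' : Empty\<rbrakk> \<Longrightarrow>
    \<Gamma> \<turnstile> IndEmpty C p \<doteq> IndEmpty C' p' : C\<langle>p\<rangle>"
| IndUnit_cong: "\<lbrakk>Unit # \<Gamma> \<turnstile> C \<doteq> C' : Univ i; \<Gamma> \<turnstile> c \<doteq> c' : C\<langle>Star\<rangle>; \<Gamma> \<turnstile> p \<doteq> p' : Unit\<rbrakk> \<Longrightarrow>
    \<Gamma> \<turnstile> IndUnit C c p \<doteq> IndUnit C' c' p' : C\<langle>p\<rangle>"
| Succ_cong: "\<Gamma> \<turnstile> n \<doteq> n' : Nat \<Longrightarrow> \<Gamma> \<turnstile> Succ n \<doteq> Succ n' : Nat"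
| IndNat_cong: "\<lbrakk>Nat # \<Gamma> \<turnstile> C : Univ i; Nat # \<Gamma> \<turnstile> C \<doteq> C' : Univ i; \<Gamma> \<turnstile> c \<doteq> c' : C\<langle>Zero\<rangle>;
    C # Nat # \<Gamma> \<turnstile> d \<doteq> d' : sub (Succ (Var 1) \<cdot> up 2) C; \<Gamma> \<turnstile> n \<doteq> n' : Nat\<rbrakk> \<Longrightarrow>
    \<Gamma> \<turnstile> IndNat C c d n \<doteq> IndNat C' c' d' n' : C\<langle>n\<rangle>"
| Id_cong: "\<lbrakk>\<Gamma> \<turnstile> A \<doteq> A' : Univ i; \<Gamma> \<turnstile> a \<doteq> a' : A; \<Gamma> \<turnstile> b \<doteq> b' : A\<rbrakk> \<Longrightarrow>
    \<Gamma> \<turnstile> Idt A a b \<doteq> Idt A' a' b' : Univ i"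
| Rfl_cong: "\<lbrakk>\<Gamma> \<turnstile> A : Univ i; \<Gamma> \<turnstile> a \<doteq> a' : A\<rbrakk> \<Longrightarrow> \<Gamma> \<turnstile> Rfl a \<doteq> Rfl a' : Idt A a a"
| IndId_cong: "\<lbrakk>\<Gamma> \<turnstile> A : Univ i;
    Idt (shift 2 A) (Var 1) (Var 0) # shift 1 A # A # \<Gamma> \<turnstile> C \<doteq> C' : Univ j;
    A # \<Gamma> \<turnstile> c \<doteq> c' : sub (Rfl (Var 0) \<cdot> Var 0 \<cdot> Var 0 \<cdot> up 1) C;
    \<Gamma> \<turnstile> a \<doteq> a' : A; \<Gamma> \<turnstile> b \<doteq> b' : A; \<Gamma> \<turnstile> p \<doteq> p' : Idt A a b\<rbrakk> \<Longrightarrow>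
    \<Gamma> \<turnstile> IndId C c a b p \<doteq> IndId C' c' a' b' p' : sub (p \<cdot> b \<cdot> a \<cdot> Var) C"
| W_cong: "\<lbrakk>\<Gamma> \<turnstile> A : Univ i; \<Gamma> \<turnstile> A \<doteq> A' : Univ i; A # \<Gamma> \<turnstile> B \<doteq> B' : Univ i\<rbrakk> \<Longrightarrow>
    \<Gamma> \<turnstile> W A B \<doteq> W A' B' : Univ i"
| Node_cong: "\<lbrakk>\<Gamma> \<turnstile> A : Univ i; A # \<Gamma> \<turnstile> B : Univ i; \<Gamma> \<turnstile> a \<doteq> a' : A;
    \<Gamma> \<turnstile> f \<doteq> f' : Pi (B\<langle>a\<rangle>) (shift 1 (W A B))\<rbrakk> \<Longrightarrow> \<Gamma> \<turnstile> Node a f \<doteq> Node a' f' : W A B"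
| IndW_cong: "\<lbrakk>\<Gamma> \<turnstile> A : Univ i; A # \<Gamma> \<turnstile> B : Univ i; W A B # \<Gamma> \<turnstile> C : Univ j;
    W A B # \<Gamma> \<turnstile> C \<doteq> C' : Univ j;
    Pi (shift 1 B) (sub (App (Var 1) (Var 0) \<cdot> up 3) C) # Pi B (shift 2 (W A B)) # A # \<Gamma> \<turnstile>
      d \<doteq> d' : sub (Node (Var 2) (Var 1) \<cdot> up 3) C;
    \<Gamma> \<turnstile> w \<doteq> w' : W A B\<rbrakk> \<Longrightarrow> \<Gamma> \<turnstile> IndW C d w \<doteq> IndW C' d' w' : C\<langle>w\<rangle>"


section \<open>Derived type formers\<close>

text \<open>
  The arguments of the following definitions are terms of one common context, hence the shifts
  under binders.
\<close>

definition Arr :: "tm \<Rightarrow> tm \<Rightarrow> tm"  (infixr "\<rightarrow>" 60) where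
  "A \<rightarrow> B = Pi A (shift 1 B)"

definition Prod :: "tm \<Rightarrow> tm \<Rightarrow> tm" where
  "Prod A B = Sig A (shift 1 B)"

definition Neg :: "tm \<Rightarrow> tm" where
  "Neg A = (A \<rightarrow> Empty)"

definition proj1 :: "tm \<Rightarrow> tm \<Rightarrow> tm" where
  "proj1 A p = IndSig (shift 1 A) (Var 1) p"

definition add :: "tm \<Rightarrow> tm \<Rightarrow> tm" where
  "add m n = IndNat Nat m (Succ (Var 0)) n"

definition Le :: "tm \<Rightarrow> tm \<Rightarrow> tm" where
  "Le m n = Sig Nat (Idt Nat (add (shift 1 m) (Var 0)) (shift 1 n))"

text \<open>\<open>Fin\<close> is defined by recursion: it sends \<open>0\<close> to \<open>Empty\<close> and \<open>n + 1\<close> to \<open>Plus (Fin n) Unit\<close>.\<close>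

definition Fin :: "tm \<Rightarrow> tm" where
  "Fin n = IndNat (Univ 0) Empty (Plus (Var 0) Unit) n"

definition Injective :: "tm \<Rightarrow> tm \<Rightarrow> tm \<Rightarrow> tm" where
  "Injective S T e = Pi S (Pi (shift 1 S)
     (Idt (shift 2 T) (App (shift 2 e) (Var 1)) (App (shift 2 e) (Var 0)) \<rightarrow>
      Idt (shift 2 S) (Var 1) (Var 0)))"

definition Surjective :: "tm \<Rightarrow> tm \<Rightarrow> tm \<Rightarrow> tm" where
  "Surjective S T e =
     Pi T (Sig (shift 1 S) (Idt (shift 2 T) (App (shift 2 e) (Var 0)) (Var 1)))"

text \<open>The type \<open>T\<close> has exactly \<open>n\<close> different terms: they are enumerated without repetition.\<close>

definition HasExactly :: "tm \<Rightarrow> tm \<Rightarrow> tm" where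
  "HasExactly n T = Sig (Fin n \<rightarrow> T)
     (Prod (Injective (shift 1 (Fin n)) (shift 1 T) (Var 0))
           (Surjective (shift 1 (Fin n)) (shift 1 T) (Var 0)))"

text \<open>The number \<open>m\<close> is the maximum of the values of \<open>g : T \<rightarrow> Nat\<close>.\<close>

definition IsMax :: "tm \<Rightarrow> tm \<Rightarrow> tm \<Rightarrow> tm" where
  "IsMax T g m = Prod
     (Pi T (Le (App (shift 1 g) (Var 0)) (shift 1 m)))
     (Sig T (Idt Nat (App (shift 1 g) (Var 0)) (shift 1 m)))"


section \<open>W-types of finite arity and complexity\<close>

text \<open>From here on \<open>B\<close> is a type family as a function term, \<open>B : A \<rightarrow> Univ i\<close>.\<close>

definition Wt :: "tm \<Rightarrow> tm \<Rightarrow> tm" where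
  "Wt A B = W A (App (shift 1 B) (Var 0))"

definition pr1 :: "tm \<Rightarrow> tm \<Rightarrow> tm" where
  "pr1 A w = IndW (shift 1 A) (Var 2) w"

definition pr2 :: "tm \<Rightarrow> tm \<Rightarrow> tm \<Rightarrow> tm" where
  "pr2 A B w =
     IndW (App (shift 1 B) (pr1 (shift 1 A) (Var 0)) \<rightarrow> shift 1 (Wt A B)) (Var 1) w"

definition IsMin :: "tm \<Rightarrow> tm \<Rightarrow> tm \<Rightarrow> tm" where
  "IsMin A B w = Neg (App B (pr1 A w))"

definition FiniteArity :: "tm \<Rightarrow> tm \<Rightarrow> tm" where
  "FiniteArity A B = Pi (Wt A B)
     (Sig Nat (HasExactly (Var 0) (App (shift 2 B) (pr1 (shift 2 A) (Var 1)))))"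

text \<open>
  The type of proofs that \<open>c : Wt A B \<rightarrow> Nat\<close> satisfies the two defining equations of the
  complexity function.  In the body of the \<open>Sig\<close>, \<open>Var 1\<close> is the tree \<open>w\<close> and \<open>Var 0\<close> the maximum of the
  complexities of the immediate subtrees of \<open>w\<close>.
\<close>

definition IsComp :: "tm \<Rightarrow> tm \<Rightarrow> tm \<Rightarrow> tm" where
  "IsComp A B c = Prod
     (Pi (Wt A B) (IsMin (shift 1 A) (shift 1 B) (Var 0) \<rightarrow>
        Idt Nat (App (shift 1 c) (Var 0)) Zero))
     (Pi (Wt A B) (Neg (IsMin (shift 1 A) (shift 1 B) (Var 0)) \<rightarrow>
        Sig Nat (Prod
          (IsMax (App (shift 2 B) (pr1 (shift 2 A) (Var 1)))
             (Lam (App (shift 2 B) (pr1 (shift 2 A) (Var 1)))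
                (App (shift 3 c) (App (pr2 (shift 3 A) (shift 3 B) (Var 2)) (Var 0))))
             (Var 0))
          (Idt Nat (App (shift 2 c) (Var 1)) (Succ (Var 0))))))"

definition Cx :: "tm \<Rightarrow> tm \<Rightarrow> tm \<Rightarrow> tm \<Rightarrow> tm" where
  "Cx A B c n = Sig (Wt A B) (Idt Nat (App (shift 1 c) (Var 0)) (shift 1 n))"

definition PiCx :: "tm \<Rightarrow> tm \<Rightarrow> tm \<Rightarrow> tm \<Rightarrow> tm \<Rightarrow> tm" where
  "PiCx A B c P n = Pi (Cx A B c n) (App (shift 1 P) (proj1 (shift 1 (Wt A B)) (Var 0)))"

end

theory Submission
  imports Defs
begin

text \<open>
  Iterating \<open>\<beta>\<close> from \<open>\<alpha>\<close> by induction on \<open>n\<close> yields a section of \<open>P\<close> over every \<open>C(n)\<close>.  Each tree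
  \<open>w\<close> gives the element \<open>(w, refl)\<close> of \<open>C(comp(w))\<close>, whose first projection computes to \<open>w\<close>, so the
  section over \<open>C(comp(w))\<close> specialises to an element of \<open>P(w)\<close> by conversion alone.  Apart from
  weakening, no admissible rule of the type theory is needed.
\<close>

section \<open>Renaming and substitution on raw terms\<close>

lemma lift_ren_simps [simp]: "lift_ren \<rho> 0 = 0" "lift_ren \<rho> (Suc i) = Suc (\<rho> i)"
  by (simp_all add: lift_ren_def)

lemma scons_simps [simp]: "(a \<cdot> \<sigma>) 0 = a" "(a \<cdot> \<sigma>) (Suc i) = \<sigma> i"
  by (simp_all add: scons_def)

lemma up_apply [simp]: "up k i = Var (i + k)"
  by (simp add: up_def)

lemma lift_sub_simps [simp]:
  "lift_sub \<sigma> 0 = Var 0" "lift_sub \<sigma> (Suc i) = ren Suc (\<sigma> i)"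
  by (simp_all add: lift_sub_def shift_def)

lemma lift_sub_Var_comp: "lift_sub (\<lambda>i. Var (\<rho> i)) = (\<lambda>i. Var (lift_ren \<rho> i))"
  by (rule ext) (simp split: nat.split add: lift_sub_def lift_ren_def scons_def shift_def)

text \<open>Seeing a renaming as a substitution by variables lets facts about two renamings follow
  from \<open>sub_ren\<close>.\<close>

lemma ren_eq_sub: "ren \<rho> t = sub (\<lambda>i. Var (\<rho> i)) t"
  by (induction t arbitrary: \<rho>) (simp_all add: lift_sub_Var_comp)

lemma sub_lift_sub_ren: "(\<lambda>i. lift_sub \<sigma> (lift_ren \<rho> i)) = lift_sub (\<lambda>i. \<sigma> (\<rho> i))"
  by (rule ext) (simp split: nat.split add: lift_sub_def lift_ren_def scons_def)

lemma sub_ren: "sub \<sigma> (ren \<rho> t) = sub (\<lambda>i. \<sigma> (\<rho> i)) t"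
  by (induction t arbitrary: \<sigma> \<rho>) (simp_all add: sub_lift_sub_ren)

lemma ren_ren: "ren \<rho> (ren \<rho>' t) = ren (\<lambda>i. \<rho> (\<rho>' i)) t"
  \<comment> \<open>Only the outer renaming is turned into a substitution, so that
    \<open>sub_ren\<close> absorbs the inner one; the result is then read back as a
    renaming.\<close>
  by (simp add: ren_eq_sub[of \<rho>] sub_ren) (simp add: ren_eq_sub)

lemma ren_lift_sub: "(\<lambda>i. ren (lift_ren \<rho>) (lift_sub \<sigma> i)) = lift_sub (\<lambda>i. ren \<rho> (\<sigma> i))"
proof
  fix i
  show "ren (lift_ren \<rho>) (lift_sub \<sigma> i) = lift_sub (\<lambda>i. ren \<rho> (\<sigma> i)) i"
    by (cases i) (simp_all add: ren_ren)
qed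

lemma ren_sub: "ren \<rho> (sub \<sigma> t) = sub (\<lambda>i. ren \<rho> (\<sigma> i)) t"
  by (induction t arbitrary: \<sigma> \<rho>) (simp_all add: ren_lift_sub)

lemma sub_cong: "(\<And>i. \<sigma> i = \<tau> i) \<Longrightarrow> sub \<sigma> t = sub \<tau> t"
  by presburger

lemma lift_sub_Var: "lift_sub Var = Var"
  using lift_sub_Var_comp[of "\<lambda>i. i"] by (simp add: lift_ren_def fun_eq_iff split: nat.split)

lemma sub_Var: "sub Var t = t"
  by (induction t) (simp_all add: lift_sub_Var)

text \<open>Index 0 does not occur in a shifted term, so instantiating it merely undoes the
  shift.\<close>

lemma inst_shift [simp]: "(shift (Suc 0) t)\<langle>a\<rangle> = t" "(ren Suc t)\<langle>a\<rangle> = t"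
  by (simp_all add: shift_def sub_ren sub_Var)

section \<open>Renaming commutes with the shapes that occur in the typing rules\<close>

lemma ren_shift [simp]:
  "ren (lift_ren \<rho>) (shift 1 t) = shift 1 (ren \<rho> t)"
  "ren (lift_ren (lift_ren \<rho>)) (shift 2 t) = shift 2 (ren \<rho> t)"
  by (simp_all add: shift_def ren_ren numeral_2_eq_2)

text \<open>By \<open>ren_sub\<close> and \<open>sub_ren\<close> both sides are a single
  substitution into \<open>t\<close>, and the two substitutions agree at every index.\<close>

lemma ren_inst [simp]:
  "ren \<rho> (t\<langle>a\<rangle>) = (ren (lift_ren \<rho>) t)\<langle>ren \<rho> a\<rangle>"
  "ren \<rho> (sub (b \<cdot> a \<cdot> Var) t) = sub (ren \<rho> b \<cdot> ren \<rho> a \<cdot> Var) (ren (lift_ren (lift_ren \<rho>)) t)"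
  "ren \<rho> (sub (c \<cdot> b \<cdot> a \<cdot> Var) t) =
    sub (ren \<rho> c \<cdot> ren \<rho> b \<cdot> ren \<rho> a \<cdot> Var) (ren (lift_ren (lift_ren (lift_ren \<rho>))) t)"
  by (auto simp: ren_sub sub_ren scons_def lift_ren_def split: nat.split intro!: sub_cong)

text \<open>These are the motives as they appear in the branches of eliminators: \<open>up 1\<close>
  for sums, \<open>up 2\<close> for pairs and numbers, \<open>up 3\<close> for trees, and three
  heads over \<open>up 1\<close> for identity types.\<close>

lemma ren_sub_up [simp]:
  "ren (lift_ren \<rho>) (sub (a \<cdot> up 1) t) =
    sub (ren (lift_ren \<rho>) a \<cdot> up 1) (ren (lift_ren \<rho>) t)"
  "ren (lift_ren (lift_ren \<rho>)) (sub (a \<cdot> up 2) t) =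
    sub (ren (lift_ren (lift_ren \<rho>)) a \<cdot> up 2) (ren (lift_ren \<rho>) t)"
  "ren (lift_ren (lift_ren (lift_ren \<rho>))) (sub (a \<cdot> up 3) t) =
    sub (ren (lift_ren (lift_ren (lift_ren \<rho>))) a \<cdot> up 3) (ren (lift_ren \<rho>) t)"
  "ren (lift_ren \<rho>) (sub (c \<cdot> b \<cdot> a \<cdot> up 1) t) =
    sub (ren (lift_ren \<rho>) c \<cdot> ren (lift_ren \<rho>) b \<cdot> ren (lift_ren \<rho>) a \<cdot> up 1)
      (ren (lift_ren (lift_ren (lift_ren \<rho>))) t)"
  by (auto simp: ren_sub sub_ren scons_def lift_ren_def numeral_2_eq_2 numeral_3_eq_3
      split: nat.split intro!: sub_cong)

text \<open>The last two equations serve \<open>W_comp\<close>, whose recursive call puts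
  \<open>C\<close> and \<open>d\<close> under one more binder by lifts of
  \<open>Suc\<close>.\<close>

lemma ren_lift_Suc [simp]:
  "ren (lift_ren \<rho>) (ren Suc t) = ren Suc (ren \<rho> t)"
  "ren (lift_ren (lift_ren \<rho>)) (ren (lift_ren Suc) t) = ren (lift_ren Suc) (ren (lift_ren \<rho>) t)"
  "ren (lift_ren (lift_ren (lift_ren (lift_ren \<rho>)))) (ren (lift_ren (lift_ren (lift_ren Suc))) t) =
    ren (lift_ren (lift_ren (lift_ren Suc))) (ren (lift_ren (lift_ren (lift_ren \<rho>))) t)"
  by (auto simp: ren_ren lift_ren_def fun_eq_iff split: nat.split
      intro!: arg_cong[where f="\<lambda>\<rho>. ren \<rho> t"])

section \<open>Weakening\<close>

text \<open>
  Only the insertion of one well-formed type is considered, since then validity of the renamed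
  context can be proved along with the judgements.  For arbitrary renamings, going under the binders
  of \<open>IndW\<close> would require a typing of the type of the induction hypotheses, hence the substitution
  lemma.
\<close>

inductive weakening :: "(nat \<Rightarrow> nat) \<Rightarrow> tm list \<Rightarrow> tm list \<Rightarrow> bool" where
  insert: "\<turnstile> T # \<Gamma> \<Longrightarrow> weakening Suc \<Gamma> (T # \<Gamma>)"
| under: "weakening \<rho> \<Gamma> \<Delta> \<Longrightarrow> weakening (lift_ren \<rho>) (A # \<Gamma>) (ren \<rho> A # \<Delta>)"

text \<open>This is what the variable rule needs: a renamed variable has the renamed type.\<close>

lemma weakening_nth:
  assumes "weakening \<rho> \<Gamma> \<Delta>" "k < length \<Gamma>"
  shows "\<rho> k < length \<Delta> \<and> shift (Suc (\<rho> k)) (\<Delta> ! \<rho> k) = ren \<rho> (shift (Suc k) (\<Gamma> ! k))"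
  using assms
proof (induction arbitrary: k rule: weakening.induct)
  case (insert T \<Gamma>)
  then show ?case by (simp add: shift_def ren_ren)
next
  case (under \<rho> \<Gamma> \<Delta> A)
  show ?case
  proof (cases k)
    case 0
    then show ?thesis by (simp add: shift_def ren_ren)
  next
    case (Suc j)
    with under have "\<rho> j < length \<Delta>" and
      *: "shift (Suc (\<rho> j)) (\<Delta> ! \<rho> j) = ren \<rho> (shift (Suc j) (\<Gamma> ! j))" by auto
    \<comment> \<open>One more shift on both sides accounts for the outermost type, which
      \<open>j\<close> and \<open>\<rho> j\<close> do not count.\<close>
    have "ren Suc (shift (Suc (\<rho> j)) (\<Delta> ! \<rho> j)) = ren Suc (ren \<rho> (shift (Suc j) (\<Gamma> ! j)))"
      by (simp only: *)
    with \<open>\<rho> j < length \<Delta>\<close> show ?thesis by (simp add: Suc shift_def ren_ren)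
  qed
qed

lemma lift_ren_numerals [simp]:
  "lift_ren (lift_ren \<rho>) 1 = 1" "lift_ren (lift_ren (lift_ren \<rho>)) 2 = 2"
  by (simp_all add: numeral_2_eq_2)

text \<open>The judgements are mutually inductive, so their weakenings are proved together: the
  renaming is pushed inwards by the commutation equations, after which the same rule applies again.
  Those equations contain the literal \<open>1\<close>, which \<open>One_nat_def\<close> would
  rewrite to \<open>Suc 0\<close> before they could match.\<close>

lemma
  notes [simp del] = One_nat_def
  shows wf_ctx_weakening: "\<turnstile> \<Gamma> \<Longrightarrow> weakening \<rho> \<Gamma> \<Delta> \<Longrightarrow> \<turnstile> \<Delta>"
    and typing_weakening: "\<Gamma> \<turnstile> a : A \<Longrightarrow> weakening \<rho> \<Gamma> \<Delta> \<Longrightarrow> \<Delta> \<turnstile> ren \<rho> a : ren \<rho> A"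
    and jeq_weakening: "\<Gamma> \<turnstile> a \<doteq> b : A \<Longrightarrow> weakening \<rho> \<Gamma> \<Delta> \<Longrightarrow> \<Delta> \<turnstile> ren \<rho> a \<doteq> ren \<rho> b : ren \<rho> A"
proof (induction arbitrary: \<rho> \<Delta> and \<rho> \<Delta> and \<rho> \<Delta> rule: wf_ctx_typing_jeq.inducts)
  case (ctx_empty \<rho> \<Delta>)
  \<comment> \<open>Only \<open>insert\<close> starts from the empty context, and it carries the
    validity of its target as a premise.\<close>
  then show ?case by cases simp_all
next
  case (ctx_ext \<Gamma> A i \<rho> \<Delta>)
  from ctx_ext.prems show ?case
  proof cases
    case (insert T)
    then show ?thesis by simp
  next
    case (under \<rho>' \<Delta>')
    then show ?thesis
      using ctx_ext.IH(1)[OF under(3)] ctx_ext.IH(2)[OF under(3)] by (simp add: wf_ctx_typing_jeq.ctx_ext)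
  qed
next
  case (var \<Gamma> k \<rho> \<Delta>)
  then show ?case
    using wf_ctx_typing_jeq.var[of \<Delta> "\<rho> k"] weakening_nth[of \<rho> \<Gamma> \<Delta> k] by simp
next
  case univ
  \<comment> \<open>Here and in the cases below, \<open>w0\<close> is the given renaming and
    \<open>w1\<close>, \<open>w2\<close>, \<open>w3\<close> are its lifts under one, two and three
    binders, one for each variable that a premise adds to the context.\<close>
  note w0 = univ.prems
  show ?case
    using univ.IH[OF w0]
    by simp (rule wf_ctx_typing_jeq.univ)
next
  case cumul
  note w0 = cumul.prems
  show ?case
    using cumul.IH[OF w0]
    by simp (rule wf_ctx_typing_jeq.cumul)
next
  case cumul_eq
  note w0 = cumul_eq.prems
  show ?case
    using cumul_eq.IH[OF w0]
    by simp (rule wf_ctx_typing_jeq.cumul_eq)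
next
  case conv
  note w0 = conv.prems
  show ?case
    using conv.IH(1)[OF w0] conv.IH(2)[OF w0]
    by simp (rule wf_ctx_typing_jeq.conv)
next
  case conv_eq
  note w0 = conv_eq.prems
  show ?case
    using conv_eq.IH(1)[OF w0] conv_eq.IH(2)[OF w0]
    by simp (rule wf_ctx_typing_jeq.conv_eq)
next
  case eq_refl
  note w0 = eq_refl.prems
  show ?case
    using eq_refl.IH[OF w0]
    by (rule wf_ctx_typing_jeq.eq_refl)
next
  case eq_sym
  note w0 = eq_sym.prems
  show ?case
    using eq_sym.IH[OF w0]
    by (rule wf_ctx_typing_jeq.eq_sym)
next
  case eq_trans
  note w0 = eq_trans.prems
  show ?case
    using eq_trans.IH(1)[OF w0] eq_trans.IH(2)[OF w0]
    by (rule wf_ctx_typing_jeq.eq_trans)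
next
  case Pi_form
  note w0 = Pi_form.prems
  note w1 = weakening.under[OF w0]
  show ?case
    using Pi_form.IH(1)[OF w0] Pi_form.IH(2)[OF w1]
    by simp (rule wf_ctx_typing_jeq.Pi_form)
next
  case Pi_intro
  note w0 = Pi_intro.prems
  note w1 = weakening.under[OF w0]
  show ?case
    using Pi_intro.IH(1)[OF w0] Pi_intro.IH(2)[OF w1]
    by simp (rule wf_ctx_typing_jeq.Pi_intro)
next
  case Pi_elim
  note w0 = Pi_elim.prems
  show ?case
    using Pi_elim.IH(1)[OF w0] Pi_elim.IH(2)[OF w0]
    by simp (rule wf_ctx_typing_jeq.Pi_elim)
next
  case Pi_comp
  note w0 = Pi_comp.prems
  note w1 = weakening.under[OF w0]
  show ?case
    using Pi_comp.IH(1)[OF w0] Pi_comp.IH(2)[OF w1] Pi_comp.IH(3)[OF w0]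
    by simp (rule wf_ctx_typing_jeq.Pi_comp)
next
  case Pi_uniq
  note w0 = Pi_uniq.prems
  show ?case
    using Pi_uniq.IH[OF w0]
    by simp (rule wf_ctx_typing_jeq.Pi_uniq)
next
  case Sig_form
  note w0 = Sig_form.prems
  note w1 = weakening.under[OF w0]
  show ?case
    using Sig_form.IH(1)[OF w0] Sig_form.IH(2)[OF w1]
    by simp (rule wf_ctx_typing_jeq.Sig_form)
next
  case Sig_intro
  note w0 = Sig_intro.prems
  note w1 = weakening.under[OF w0]
  show ?case
    using Sig_intro.IH(1)[OF w0] Sig_intro.IH(2)[OF w1] Sig_intro.IH(3)[OF w0]
      Sig_intro.IH(4)[OF w0]
    by simp (rule wf_ctx_typing_jeq.Sig_intro)
next
  case Sig_elim
  note w0 = Sig_elim.prems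
  note w1 = weakening.under[OF w0]
  note w2 = weakening.under[OF w1]
  show ?case
    using Sig_elim.IH(1)[OF w0] Sig_elim.IH(2)[OF w1] Sig_elim.IH(3)[OF w1]
      Sig_elim.IH(4)[OF w2] Sig_elim.IH(5)[OF w0]
    by simp (rule wf_ctx_typing_jeq.Sig_elim)
next
  case Sig_comp
  note w0 = Sig_comp.prems
  note w1 = weakening.under[OF w0]
  note w2 = weakening.under[OF w1]
  show ?case
    using Sig_comp.IH(1)[OF w0] Sig_comp.IH(2)[OF w1] Sig_comp.IH(3)[OF w1]
      Sig_comp.IH(4)[OF w2] Sig_comp.IH(5)[OF w0] Sig_comp.IH(6)[OF w0]
    by simp (rule wf_ctx_typing_jeq.Sig_comp)
next
  case Plus_form
  note w0 = Plus_form.prems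
  show ?case
    using Plus_form.IH(1)[OF w0] Plus_form.IH(2)[OF w0]
    by simp (rule wf_ctx_typing_jeq.Plus_form)
next
  case Plus_intro1
  note w0 = Plus_intro1.prems
  show ?case
    using Plus_intro1.IH(1)[OF w0] Plus_intro1.IH(2)[OF w0] Plus_intro1.IH(3)[OF w0]
    by simp (rule wf_ctx_typing_jeq.Plus_intro1)
next
  case Plus_intro2
  note w0 = Plus_intro2.prems
  show ?case
    using Plus_intro2.IH(1)[OF w0] Plus_intro2.IH(2)[OF w0] Plus_intro2.IH(3)[OF w0]
    by simp (rule wf_ctx_typing_jeq.Plus_intro2)
next
  case Plus_elim
  note w0 = Plus_elim.prems
  note w1 = weakening.under[OF w0]
  show ?case
    using Plus_elim.IH(1)[OF w0] Plus_elim.IH(2)[OF w0] Plus_elim.IH(3)[OF w1]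
      Plus_elim.IH(4)[OF w1] Plus_elim.IH(5)[OF w1] Plus_elim.IH(6)[OF w0]
    by simp (rule wf_ctx_typing_jeq.Plus_elim)
next
  case Plus_comp1
  note w0 = Plus_comp1.prems
  note w1 = weakening.under[OF w0]
  show ?case
    using Plus_comp1.IH(1)[OF w0] Plus_comp1.IH(2)[OF w0] Plus_comp1.IH(3)[OF w1]
      Plus_comp1.IH(4)[OF w1] Plus_comp1.IH(5)[OF w1] Plus_comp1.IH(6)[OF w0]
    by simp (rule wf_ctx_typing_jeq.Plus_comp1)
next
  case Plus_comp2
  note w0 = Plus_comp2.prems
  note w1 = weakening.under[OF w0]
  show ?case
    using Plus_comp2.IH(1)[OF w0] Plus_comp2.IH(2)[OF w0] Plus_comp2.IH(3)[OF w1]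
      Plus_comp2.IH(4)[OF w1] Plus_comp2.IH(5)[OF w1] Plus_comp2.IH(6)[OF w0]
    by simp (rule wf_ctx_typing_jeq.Plus_comp2)
next
  case Empty_form
  note w0 = Empty_form.prems
  show ?case
    using Empty_form.IH[OF w0]
    by simp (rule wf_ctx_typing_jeq.Empty_form)
next
  case Empty_elim
  note w0 = Empty_elim.prems
  note w1 = weakening.under[OF w0]
  show ?case
    using Empty_elim.IH(1)[OF w1] Empty_elim.IH(2)[OF w0]
    by simp (rule wf_ctx_typing_jeq.Empty_elim)
next
  case Unit_form
  note w0 = Unit_form.prems
  show ?case
    using Unit_form.IH[OF w0]
    by simp (rule wf_ctx_typing_jeq.Unit_form)
next
  case Unit_intro
  note w0 = Unit_intro.prems
  show ?case
    using Unit_intro.IH[OF w0]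
    by simp (rule wf_ctx_typing_jeq.Unit_intro)
next
  case Unit_elim
  note w0 = Unit_elim.prems
  note w1 = weakening.under[OF w0]
  show ?case
    using Unit_elim.IH(1)[OF w1] Unit_elim.IH(2)[OF w0] Unit_elim.IH(3)[OF w0]
    by simp (rule wf_ctx_typing_jeq.Unit_elim)
next
  case Unit_comp
  note w0 = Unit_comp.prems
  note w1 = weakening.under[OF w0]
  show ?case
    using Unit_comp.IH(1)[OF w1] Unit_comp.IH(2)[OF w0]
    by simp (rule wf_ctx_typing_jeq.Unit_comp)
next
  case Nat_form
  note w0 = Nat_form.prems
  show ?case
    using Nat_form.IH[OF w0]
    by simp (rule wf_ctx_typing_jeq.Nat_form)
next
  case Nat_intro1
  note w0 = Nat_intro1.prems
  show ?case
    using Nat_intro1.IH[OF w0]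
    by simp (rule wf_ctx_typing_jeq.Nat_intro1)
next
  case Nat_intro2
  note w0 = Nat_intro2.prems
  show ?case
    using Nat_intro2.IH[OF w0]
    by simp (rule wf_ctx_typing_jeq.Nat_intro2)
next
  case Nat_elim
  note w0 = Nat_elim.prems
  note w1 = weakening.under[OF w0]
  note w2 = weakening.under[OF w1]
  show ?case
    using Nat_elim.IH(1)[OF w1] Nat_elim.IH(2)[OF w0] Nat_elim.IH(3)[OF w2]
      Nat_elim.IH(4)[OF w0]
    by simp (rule wf_ctx_typing_jeq.Nat_elim)
next
  case Nat_comp1
  note w0 = Nat_comp1.prems
  note w1 = weakening.under[OF w0]
  note w2 = weakening.under[OF w1]
  show ?case
    using Nat_comp1.IH(1)[OF w1] Nat_comp1.IH(2)[OF w0] Nat_comp1.IH(3)[OF w2]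
    by simp (rule wf_ctx_typing_jeq.Nat_comp1)
next
  case Nat_comp2
  note w0 = Nat_comp2.prems
  note w1 = weakening.under[OF w0]
  note w2 = weakening.under[OF w1]
  show ?case
    using Nat_comp2.IH(1)[OF w1] Nat_comp2.IH(2)[OF w0] Nat_comp2.IH(3)[OF w2]
      Nat_comp2.IH(4)[OF w0]
    by simp (rule wf_ctx_typing_jeq.Nat_comp2)
next
  case Id_form
  note w0 = Id_form.prems
  show ?case
    using Id_form.IH(1)[OF w0] Id_form.IH(2)[OF w0] Id_form.IH(3)[OF w0]
    by simp (rule wf_ctx_typing_jeq.Id_form)
next
  case Id_intro
  note w0 = Id_intro.prems
  show ?case
    using Id_intro.IH(1)[OF w0] Id_intro.IH(2)[OF w0]
    by simp (rule wf_ctx_typing_jeq.Id_intro)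
next
  case Id_elim
  note w0 = Id_elim.prems
  note w1 = weakening.under[OF w0]
  note w2 = weakening.under[OF w1]
  note w3 = weakening.under[OF w2]
  show ?case
    using Id_elim.IH(1)[OF w0] Id_elim.IH(2)[OF w3] Id_elim.IH(3)[OF w1] Id_elim.IH(4)[OF
      w0] Id_elim.IH(5)[OF w0] Id_elim.IH(6)[OF w0]
    by simp (rule wf_ctx_typing_jeq.Id_elim)
next
  case Id_comp
  note w0 = Id_comp.prems
  note w1 = weakening.under[OF w0]
  note w2 = weakening.under[OF w1]
  note w3 = weakening.under[OF w2]
  show ?case
    using Id_comp.IH(1)[OF w0] Id_comp.IH(2)[OF w3] Id_comp.IH(3)[OF w1] Id_comp.IH(4)[OF
      w0]
    by simp (rule wf_ctx_typing_jeq.Id_comp)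
next
  case W_form
  note w0 = W_form.prems
  note w1 = weakening.under[OF w0]
  show ?case
    using W_form.IH(1)[OF w0] W_form.IH(2)[OF w1]
    by simp (rule wf_ctx_typing_jeq.W_form)
next
  case W_intro
  note w0 = W_intro.prems
  note w1 = weakening.under[OF w0]
  show ?case
    using W_intro.IH(1)[OF w0] W_intro.IH(2)[OF w1] W_intro.IH(3)[OF w0] W_intro.IH(4)[OF
      w0]
    by simp (rule wf_ctx_typing_jeq.W_intro)
next
  case W_elim
  note w0 = W_elim.prems
  note w1 = weakening.under[OF w0]
  note w2 = weakening.under[OF w1]
  note w3 = weakening.under[OF w2]
  show ?case
    \<comment> \<open>The branch lives over a label, its subtrees and the induction hypotheses,
      hence \<open>w3\<close>.\<close>
    using W_elim.IH(1)[OF w0] W_elim.IH(2)[OF w1] W_elim.IH(3)[OF w1] W_elim.IH(4)[OF w3]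
      W_elim.IH(5)[OF w0]
    by simp (rule wf_ctx_typing_jeq.W_elim)
next
  case W_comp
  note w0 = W_comp.prems
  note w1 = weakening.under[OF w0]
  note w2 = weakening.under[OF w1]
  note w3 = weakening.under[OF w2]
  show ?case
    using W_comp.IH(1)[OF w0] W_comp.IH(2)[OF w1] W_comp.IH(3)[OF w1] W_comp.IH(4)[OF w3]
      W_comp.IH(5)[OF w0] W_comp.IH(6)[OF w0]
    by simp (rule wf_ctx_typing_jeq.W_comp)
next
  case Pi_cong
  note w0 = Pi_cong.prems
  note w1 = weakening.under[OF w0]
  show ?case
    using Pi_cong.IH(1)[OF w0] Pi_cong.IH(2)[OF w0] Pi_cong.IH(3)[OF w1]
    by simp (rule wf_ctx_typing_jeq.Pi_cong)
next
  case Lam_cong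
  note w0 = Lam_cong.prems
  note w1 = weakening.under[OF w0]
  show ?case
    using Lam_cong.IH(1)[OF w0] Lam_cong.IH(2)[OF w0] Lam_cong.IH(3)[OF w1]
    by simp (rule wf_ctx_typing_jeq.Lam_cong)
next
  case App_cong
  note w0 = App_cong.prems
  show ?case
    using App_cong.IH(1)[OF w0] App_cong.IH(2)[OF w0]
    by simp (rule wf_ctx_typing_jeq.App_cong)
next
  case Sig_cong
  note w0 = Sig_cong.prems
  note w1 = weakening.under[OF w0]
  show ?case
    using Sig_cong.IH(1)[OF w0] Sig_cong.IH(2)[OF w0] Sig_cong.IH(3)[OF w1]
    by simp (rule wf_ctx_typing_jeq.Sig_cong)
next
  case Pr_cong
  note w0 = Pr_cong.prems
  note w1 = weakening.under[OF w0]
  show ?case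
    using Pr_cong.IH(1)[OF w0] Pr_cong.IH(2)[OF w1] Pr_cong.IH(3)[OF w0] Pr_cong.IH(4)[OF
      w0]
    by simp (rule wf_ctx_typing_jeq.Pr_cong)
next
  case IndSig_cong
  note w0 = IndSig_cong.prems
  note w1 = weakening.under[OF w0]
  note w2 = weakening.under[OF w1]
  show ?case
    using IndSig_cong.IH(1)[OF w0] IndSig_cong.IH(2)[OF w1] IndSig_cong.IH(3)[OF w1]
      IndSig_cong.IH(4)[OF w2] IndSig_cong.IH(5)[OF w0]
    by simp (rule wf_ctx_typing_jeq.IndSig_cong)
next
  case Plus_cong
  note w0 = Plus_cong.prems
  show ?case
    using Plus_cong.IH(1)[OF w0] Plus_cong.IH(2)[OF w0]
    by simp (rule wf_ctx_typing_jeq.Plus_cong)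
next
  case Inj1_cong
  note w0 = Inj1_cong.prems
  show ?case
    using Inj1_cong.IH(1)[OF w0] Inj1_cong.IH(2)[OF w0] Inj1_cong.IH(3)[OF w0]
    by simp (rule wf_ctx_typing_jeq.Inj1_cong)
next
  case Inj2_cong
  note w0 = Inj2_cong.prems
  show ?case
    using Inj2_cong.IH(1)[OF w0] Inj2_cong.IH(2)[OF w0] Inj2_cong.IH(3)[OF w0]
    by simp (rule wf_ctx_typing_jeq.Inj2_cong)
next
  case IndPlus_cong
  note w0 = IndPlus_cong.prems
  note w1 = weakening.under[OF w0]
  show ?case
    using IndPlus_cong.IH(1)[OF w0] IndPlus_cong.IH(2)[OF w0] IndPlus_cong.IH(3)[OF w1]
      IndPlus_cong.IH(4)[OF w1] IndPlus_cong.IH(5)[OF w1] IndPlus_cong.IH(6)[OF w0]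
    by simp (rule wf_ctx_typing_jeq.IndPlus_cong)
next
  case IndEmpty_cong
  note w0 = IndEmpty_cong.prems
  note w1 = weakening.under[OF w0]
  show ?case
    using IndEmpty_cong.IH(1)[OF w1] IndEmpty_cong.IH(2)[OF w0]
    by simp (rule wf_ctx_typing_jeq.IndEmpty_cong)
next
  case IndUnit_cong
  note w0 = IndUnit_cong.prems
  note w1 = weakening.under[OF w0]
  show ?case
    using IndUnit_cong.IH(1)[OF w1] IndUnit_cong.IH(2)[OF w0] IndUnit_cong.IH(3)[OF w0]
    by simp (rule wf_ctx_typing_jeq.IndUnit_cong)
next
  case Succ_cong
  note w0 = Succ_cong.prems
  show ?case
    using Succ_cong.IH[OF w0]
    by simp (rule wf_ctx_typing_jeq.Succ_cong)
next
  case IndNat_cong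
  note w0 = IndNat_cong.prems
  note w1 = weakening.under[OF w0]
  note w2 = weakening.under[OF w1]
  show ?case
    using IndNat_cong.IH(1)[OF w1] IndNat_cong.IH(2)[OF w1] IndNat_cong.IH(3)[OF w0]
      IndNat_cong.IH(4)[OF w2] IndNat_cong.IH(5)[OF w0]
    by simp (rule wf_ctx_typing_jeq.IndNat_cong)
next
  case Id_cong
  note w0 = Id_cong.prems
  show ?case
    using Id_cong.IH(1)[OF w0] Id_cong.IH(2)[OF w0] Id_cong.IH(3)[OF w0]
    by simp (rule wf_ctx_typing_jeq.Id_cong)
next
  case Rfl_cong
  note w0 = Rfl_cong.prems
  show ?case
    using Rfl_cong.IH(1)[OF w0] Rfl_cong.IH(2)[OF w0]
    by simp (rule wf_ctx_typing_jeq.Rfl_cong)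
next
  case IndId_cong
  note w0 = IndId_cong.prems
  note w1 = weakening.under[OF w0]
  note w2 = weakening.under[OF w1]
  note w3 = weakening.under[OF w2]
  show ?case
    using IndId_cong.IH(1)[OF w0] IndId_cong.IH(2)[OF w3] IndId_cong.IH(3)[OF w1]
      IndId_cong.IH(4)[OF w0] IndId_cong.IH(5)[OF w0] IndId_cong.IH(6)[OF w0]
    by simp (rule wf_ctx_typing_jeq.IndId_cong)
next
  case W_cong
  note w0 = W_cong.prems
  note w1 = weakening.under[OF w0]
  show ?case
    using W_cong.IH(1)[OF w0] W_cong.IH(2)[OF w0] W_cong.IH(3)[OF w1]
    by simp (rule wf_ctx_typing_jeq.W_cong)
next
  case Node_cong
  note w0 = Node_cong.prems
  note w1 = weakening.under[OF w0]
  show ?case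
    using Node_cong.IH(1)[OF w0] Node_cong.IH(2)[OF w1] Node_cong.IH(3)[OF w0]
      Node_cong.IH(4)[OF w0]
    by simp (rule wf_ctx_typing_jeq.Node_cong)
next
  case IndW_cong
  note w0 = IndW_cong.prems
  note w1 = weakening.under[OF w0]
  note w2 = weakening.under[OF w1]
  note w3 = weakening.under[OF w2]
  show ?case
    using IndW_cong.IH(1)[OF w0] IndW_cong.IH(2)[OF w1] IndW_cong.IH(3)[OF w1]
      IndW_cong.IH(4)[OF w1] IndW_cong.IH(5)[OF w3] IndW_cong.IH(6)[OF w0]
    by simp (rule wf_ctx_typing_jeq.IndW_cong)
qed

section \<open>Presuppositions and derived rules for functions\<close>

lemma typing_wf_ctx: "\<Gamma> \<turnstile> a : A \<Longrightarrow> \<turnstile> \<Gamma>"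
  and jeq_wf_ctx: "\<Gamma> \<turnstile> a \<doteq> b : A \<Longrightarrow> \<turnstile> \<Gamma>"
  \<comment> \<open>Every typing or equality rule has a premise in the context of its conclusion,
    either a judgement or the validity of that context itself, so nothing has to be shown about
    contexts.\<close>
  by (induction rule: wf_ctx_typing_jeq.inducts(2,3)[where ?P1.0="\<lambda>_. True"]) simp_all

lemma typing_shift:
  assumes "\<turnstile> T # \<Gamma>" "\<Gamma> \<turnstile> a : A"
  shows "T # \<Gamma> \<turnstile> shift 1 a : shift 1 A"
  using typing_weakening[OF assms(2) weakening.insert[OF assms(1)]] by (simp add: shift_def)

lemma Arr_elim: "\<lbrakk>\<Gamma> \<turnstile> f : A \<rightarrow> B; \<Gamma> \<turnstile> a : A\<rbrakk> \<Longrightarrow> \<Gamma> \<turnstile> App f a : B"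
  using Pi_elim[of \<Gamma> f A "shift 1 B" a] by (simp add: Arr_def)

lemma typing_Var_0: "\<turnstile> A # \<Gamma> \<Longrightarrow> A # \<Gamma> \<turnstile> Var 0 : shift 1 A"
  using var[of "A # \<Gamma>" 0] by simp

section \<open>Derived type formers under renaming\<close>

lemma ren_Arr: "ren \<rho> (A \<rightarrow> B) = ren \<rho> A \<rightarrow> ren \<rho> B"
  by (simp add: Arr_def shift_def ren_ren)

lemma ren_Wt: "ren \<rho> (Wt A B) = Wt (ren \<rho> A) (ren \<rho> B)"
  by (simp add: Wt_def shift_def ren_ren)

lemma ren_Cx: "ren \<rho> (Cx A B c n) = Cx (ren \<rho> A) (ren \<rho> B) (ren \<rho> c) (ren \<rho> n)"
  by (simp add: Cx_def ren_Wt shift_def ren_ren)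

lemma ren_PiCx:
  "ren \<rho> (PiCx A B c P n) = PiCx (ren \<rho> A) (ren \<rho> B) (ren \<rho> c) (ren \<rho> P) (ren \<rho> n)"
  by (simp add: PiCx_def ren_Cx ren_Wt proj1_def shift_def ren_ren)

lemma shift_simps [simp]:
  "shift k (Univ i) = Univ i" "shift k Nat = Nat" "shift k (Var i) = Var (i + k)"
  "shift k (App f a) = App (shift k f) (shift k a)" "shift k (Succ a) = Succ (shift k a)"
  "shift k (A \<rightarrow> B) = shift k A \<rightarrow> shift k B"
  "shift k (Wt A B) = Wt (shift k A) (shift k B)"
  "shift k (Cx A B c n) = Cx (shift k A) (shift k B) (shift k c) (shift k n)"
  "shift k (PiCx A B c P n) = PiCx (shift k A) (shift k B) (shift k c) (shift k P) (shift k n)"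
  by (simp_all add: shift_def ren_Arr ren_Wt ren_Cx ren_PiCx)

lemma Pi_elim_Var:
  assumes "\<Gamma> \<turnstile> f : Pi A B" "\<turnstile> A # \<Gamma>"
  shows "A # \<Gamma> \<turnstile> App (shift 1 f) (Var 0) : B"
proof -
  \<comment> \<open>Weakening \<open>B\<close> below its own variable and then putting the new
    \<open>Var 0\<close> for that variable is the identity, so the application has type
    \<open>B\<close> itself.\<close>
  have "(\<lambda>i. (Var 0 \<cdot> Var) (lift_ren Suc i)) = Var"
    by (rule ext) (simp add: lift_ren_def scons_def split: nat.split)
  then show ?thesis
    using Pi_elim[OF _ typing_Var_0, of A \<Gamma> "shift 1 f" "ren (lift_ren Suc) B"] typing_shift[OF assms(2,1)]
      assms(2) by (simp add: shift_def sub_ren sub_Var)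
qed

section \<open>Formation of the W-type, of the levels \<open>Cx\<close> and of the sections over a
  level\<close>

lemma Wt_form:
  assumes A: "\<Gamma> \<turnstile> A : Univ i" and B: "\<Gamma> \<turnstile> B : A \<rightarrow> Univ i"
  shows "\<Gamma> \<turnstile> Wt A B : Univ i"
proof -
  have wf: "\<turnstile> A # \<Gamma>" using typing_wf_ctx[OF A] A by (rule ctx_ext)
  have "A # \<Gamma> \<turnstile> App (shift 1 B) (Var 0) : Univ i"
    using typing_shift[OF wf B] typing_Var_0[OF wf] by (auto intro: Arr_elim)
  with A show ?thesis unfolding Wt_def by (rule W_form)
qed

text \<open>\<open>Nat\<close> lies in every universe, so this family can be formed in the universe
  of \<open>A\<close>, as the rules for \<open>Sig\<close> require.\<close>

lemma Cx_family:
  assumes wf: "\<turnstile> T # \<Gamma>" and c: "\<Gamma> \<turnstile> c : T \<rightarrow> Nat" and n: "\<Gamma> \<turnstile> n : Nat"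
  shows "T # \<Gamma> \<turnstile> Idt Nat (App (shift 1 c) (Var 0)) (shift 1 n) : Univ i"
  using wf typing_shift[OF wf c] typing_shift[OF wf n] typing_Var_0[OF wf]
  by (auto intro!: Id_form Nat_form intro: Arr_elim)

lemma Cx_form:
  assumes "\<Gamma> \<turnstile> A : Univ i" "\<Gamma> \<turnstile> B : A \<rightarrow> Univ i" "\<Gamma> \<turnstile> c : Wt A B \<rightarrow> Nat" "\<Gamma> \<turnstile> n : Nat"
  shows "\<Gamma> \<turnstile> Cx A B c n : Univ i"
proof -
  have W: "\<Gamma> \<turnstile> Wt A B : Univ i" by (rule Wt_form[OF assms(1,2)])
  then show ?thesis unfolding Cx_def
    by (rule Sig_form[OF _ Cx_family[OF ctx_ext[OF typing_wf_ctx[OF W] W] assms(3,4)]])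
qed

text \<open>The motive of \<open>proj1\<close> is constant in the pair, so replacing the pair by its
  two components leaves only the shift past them.\<close>

lemma sub_Pr_shift: "sub (Pr (Var 1) (Var 0) \<cdot> up 2) (shift 1 A) = shift 2 A"
  by (simp add: shift_def sub_ren) (simp add: ren_eq_sub)

lemma proj1_typing:
  assumes A: "\<Gamma> \<turnstile> A : Univ i" and B: "A # \<Gamma> \<turnstile> B : Univ i"
  shows "\<Gamma> \<turnstile> p : Sig A B \<Longrightarrow> \<Gamma> \<turnstile> proj1 A p : A"
    and "\<lbrakk>\<Gamma> \<turnstile> a : A; \<Gamma> \<turnstile> b : B\<langle>a\<rangle>\<rbrakk> \<Longrightarrow> \<Gamma> \<turnstile> proj1 A (Pr a b) \<doteq> a : A"
proof -
  have wfA: "\<turnstile> A # \<Gamma>" using typing_wf_ctx[OF A] A by (rule ctx_ext)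
  have wfB: "\<turnstile> B # A # \<Gamma>" using wfA B by (rule ctx_ext)
  have wfS: "\<turnstile> Sig A B # \<Gamma>" using typing_wf_ctx[OF A] Sig_form[OF A B] by (rule ctx_ext)
  have C: "Sig A B # \<Gamma> \<turnstile> shift 1 A : Univ i"
    using typing_shift[OF wfS A] by simp
  \<comment> \<open>In the branch \<open>Var 1\<close> is the first component and
    \<open>Var 0\<close> the second.\<close>
  have g: "B # A # \<Gamma> \<turnstile> Var 1 : sub (Pr (Var 1) (Var 0) \<cdot> up 2) (shift 1 A)"
    using var[OF wfB, of 1] sub_Pr_shift[of A] by (simp add: numeral_2_eq_2)
  show "\<Gamma> \<turnstile> proj1 A p : A" if "\<Gamma> \<turnstile> p : Sig A B"
    using Sig_elim[OF A B C g that] by (simp add: proj1_def)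
  show "\<Gamma> \<turnstile> proj1 A (Pr a b) \<doteq> a : A" if "\<Gamma> \<turnstile> a : A" "\<Gamma> \<turnstile> b : B\<langle>a\<rangle>"
    using Sig_comp[OF A B C g that] by (simp add: proj1_def)
qed

text \<open>The type argument is shifted, so the head \<open>a\<close> of the substitution reaches
  only \<open>p\<close>.\<close>

lemma sub_proj1: "sub (a \<cdot> \<sigma>) (proj1 (shift (Suc 0) A) p) = proj1 (sub \<sigma> A) (sub (a \<cdot> \<sigma>) p)"
  by (simp add: proj1_def shift_def sub_ren ren_sub)

lemma PiCx_form:
  assumes A: "\<Gamma> \<turnstile> A : Univ i" and B: "\<Gamma> \<turnstile> B : A \<rightarrow> Univ i" and c: "\<Gamma> \<turnstile> c : Wt A B \<rightarrow> Nat"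
    and P: "\<Gamma> \<turnstile> P : Wt A B \<rightarrow> Univ i" and n: "\<Gamma> \<turnstile> n : Nat"
  shows "\<Gamma> \<turnstile> PiCx A B c P n : Univ i"
proof -
  let ?C = "Cx A B c n"
  have C: "\<Gamma> \<turnstile> ?C : Univ i" by (rule Cx_form[OF A B c n])
  have wf: "\<turnstile> ?C # \<Gamma>" using typing_wf_ctx[OF A] C by (rule ctx_ext)
  \<comment> \<open>The family \<open>P\<close> is applied to a projection from the bound element of
    \<open>?C\<close>, so all parameters are first moved under that binder.\<close>
  have A': "?C # \<Gamma> \<turnstile> shift 1 A : Univ i" using typing_shift[OF wf A] by simp
  have B': "?C # \<Gamma> \<turnstile> shift 1 B : shift 1 A \<rightarrow> Univ i" using typing_shift[OF wf B] by simp
  have c': "?C # \<Gamma> \<turnstile> shift 1 c : Wt (shift 1 A) (shift 1 B) \<rightarrow> Nat"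
    using typing_shift[OF wf c] by simp
  have n': "?C # \<Gamma> \<turnstile> shift 1 n : Nat" using typing_shift[OF wf n] by simp
  have P': "?C # \<Gamma> \<turnstile> shift 1 P : Wt (shift 1 A) (shift 1 B) \<rightarrow> Univ i"
    using typing_shift[OF wf P] by simp
  have W': "?C # \<Gamma> \<turnstile> Wt (shift 1 A) (shift 1 B) : Univ i" by (rule Wt_form[OF A' B'])
  have "?C # \<Gamma> \<turnstile> proj1 (Wt (shift 1 A) (shift 1 B)) (Var 0) : Wt (shift 1 A) (shift 1 B)"
    \<comment> \<open>\<open>Cx\<close> is unfolded only at the shifted \<open>c\<close>, that is,
      in the type of \<open>Var 0\<close>; its occurrence in the context stays folded.\<close>
    using proj1_typing(1)[OF W' Cx_family[OF ctx_ext[OF wf W'] c' n'], of "Var 0"] typing_Var_0[OF wf]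
    by (simp add: Cx_def[of _ _ "shift (Suc 0) c"])
  then have "?C # \<Gamma> \<turnstile> App (shift 1 P) (proj1 (shift 1 (Wt A B)) (Var 0)) : Univ i"
    using P' by (auto intro: Arr_elim)
  with C show ?thesis unfolding PiCx_def by (rule Pi_form)
qed

text \<open>All parameters but the level are shifted, so the head \<open>a\<close> reaches only
  \<open>n\<close>. This computes every instance of the motive in the induction on the
  level.\<close>

lemma sub_PiCx:
  "sub (a \<cdot> \<sigma>) (PiCx (shift 1 A) (shift 1 B) (shift 1 c) (shift 1 P) n) =
    PiCx (sub \<sigma> A) (sub \<sigma> B) (sub \<sigma> c) (sub \<sigma> P) (sub (a \<cdot> \<sigma>) n)"
  by (simp add: PiCx_def Cx_def Wt_def proj1_def shift_def sub_ren ren_sub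
      ren_lift_sub[symmetric])

section \<open>Induction on the level, and the section over all trees\<close>

lemma PiCx_induct:
  assumes A: "\<Gamma> \<turnstile> A : Univ i" and B: "\<Gamma> \<turnstile> B : A \<rightarrow> Univ i" and c: "\<Gamma> \<turnstile> c : Wt A B \<rightarrow> Nat"
    and P: "\<Gamma> \<turnstile> P : Wt A B \<rightarrow> Univ i" and \<alpha>: "\<Gamma> \<turnstile> \<alpha> : PiCx A B c P Zero"
    and \<beta>: "\<Gamma> \<turnstile> \<beta> : Pi Nat (PiCx (shift 1 A) (shift 1 B) (shift 1 c) (shift 1 P) (Var 0) \<rightarrow>
                          PiCx (shift 1 A) (shift 1 B) (shift 1 c) (shift 1 P) (Succ (Var 0)))"
    and n: "\<Gamma> \<turnstile> n : Nat"
  obtains d where "\<Gamma> \<turnstile> d : PiCx A B c P n"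
proof -
  \<comment> \<open>The motive of \<open>Nat_elim\<close>: the type of sections over the level
    \<open>Var 0\<close>.\<close>
  let ?C = "PiCx (shift 1 A) (shift 1 B) (shift 1 c) (shift 1 P) (Var 0)"
  have wf: "\<turnstile> Nat # \<Gamma>" by (rule ctx_ext[OF typing_wf_ctx[OF A] Nat_form[OF typing_wf_ctx[OF A]]])
  have C: "Nat # \<Gamma> \<turnstile> ?C : Univ i"
    using typing_shift[OF wf A] typing_shift[OF wf B] typing_shift[OF wf c] typing_shift[OF wf P]
      typing_Var_0[OF wf] by (intro PiCx_form) simp_all
  have wfC: "\<turnstile> ?C # Nat # \<Gamma>" using wf C by (rule ctx_ext)
  \<comment> \<open>This is \<beta> applied to the predecessor and then to the induction hypothesis:
    the inner \<open>Var 0\<close> is the number, which the outer shift makes \<open>Var 1\<close>,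
    and the last \<open>Var 0\<close> is the hypothesis.\<close>
  let ?d = "App (shift 1 (App (shift 1 \<beta>) (Var 0))) (Var 0)"
  have "?C # Nat # \<Gamma> \<turnstile> ?d :
      shift 1 (PiCx (shift 1 A) (shift 1 B) (shift 1 c) (shift 1 P) (Succ (Var 0)))"
    using typing_shift[OF wfC Pi_elim_Var[OF \<beta> wf]] typing_Var_0[OF wfC]
    by (intro Arr_elim[where A="shift 1 ?C"]) (simp_all only: shift_simps)
  \<comment> \<open>Moving the codomain of \<beta> past the hypothesis gives the motive at the
    successor, in the form \<open>Nat_elim\<close> expects.\<close>
  moreover have "shift 1 (PiCx (shift 1 A) (shift 1 B) (shift 1 c) (shift 1 P) (Succ (Var 0))) =
      sub (Succ (Var 1) \<cdot> up 2) ?C"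
    by (simp only: sub_PiCx shift_simps) (simp add: shift_def ren_ren up_def, simp add: ren_eq_sub)
  ultimately have d: "?C # Nat # \<Gamma> \<turnstile> ?d : sub (Succ (Var 1) \<cdot> up 2) ?C" by simp
  have \<alpha>': "\<Gamma> \<turnstile> \<alpha> : ?C\<langle>Zero\<rangle>" using \<alpha> by (simp only: sub_PiCx) (simp add: sub_Var)
  have "?C\<langle>n\<rangle> = PiCx A B c P n" by (simp only: sub_PiCx) (simp add: sub_Var)
  with Nat_elim[OF C \<alpha>' d n] that show thesis by simp
qed

theorem proposition6:
  fixes \<Gamma> :: "tm list" and A B P fin comp spec \<alpha> \<beta> :: tm and i :: nat
  assumes "\<Gamma> \<turnstile> A : Univ i"
    and "\<Gamma> \<turnstile> B : A \<rightarrow> Univ i"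
    and "\<Gamma> \<turnstile> fin : FiniteArity A B"
    and "\<Gamma> \<turnstile> comp : Wt A B \<rightarrow> Nat"
    and "\<Gamma> \<turnstile> spec : IsComp A B comp"
    and "\<Gamma> \<turnstile> P : Wt A B \<rightarrow> Univ i"
    and "\<Gamma> \<turnstile> \<alpha> : PiCx A B comp P Zero"
    and "\<Gamma> \<turnstile> \<beta> : Pi Nat (PiCx (shift 1 A) (shift 1 B) (shift 1 comp) (shift 1 P) (Var 0) \<rightarrow>
                        PiCx (shift 1 A) (shift 1 B) (shift 1 comp) (shift 1 P) (Succ (Var 0)))"
  shows "\<exists>\<gamma>. \<Gamma> \<turnstile> \<gamma> : Pi (Wt A B) (App (shift 1 P) (Var 0))"
proof -
  have W: "\<Gamma> \<turnstile> Wt A B : Univ i" by (rule Wt_form[OF assms(1,2)])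
  have wf: "\<turnstile> Wt A B # \<Gamma>" using typing_wf_ctx[OF W] W by (rule ctx_ext)
  \<comment> \<open>The value of the section is built over a generic tree, which is
    \<open>Var 0\<close> in \<Delta>; all data are weakened to \<Delta>.\<close>
  define \<Delta> where "\<Delta> = Wt A B # \<Gamma>"
  define A' B' c' P' where "A' = shift 1 A" and "B' = shift 1 B" and "c' = shift 1 comp"
    and "P' = shift 1 P"
  note defs = \<Delta>_def A'_def B'_def c'_def P'_def
  have A': "\<Delta> \<turnstile> A' : Univ i" and B': "\<Delta> \<turnstile> B' : A' \<rightarrow> Univ i" and c': "\<Delta> \<turnstile> c' : Wt A' B' \<rightarrow> Nat"
    and P': "\<Delta> \<turnstile> P' : Wt A' B' \<rightarrow> Univ i" and \<alpha>': "\<Delta> \<turnstile> shift 1 \<alpha> : PiCx A' B' c' P' Zero"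
    using assms(1,2,4,6,7)[THEN typing_shift[OF wf]] by (simp_all add: defs) (simp add: shift_def)
  have \<beta>': "\<Delta> \<turnstile> shift 1 \<beta> : Pi Nat (PiCx (shift 1 A') (shift 1 B') (shift 1 c') (shift 1 P') (Var 0) \<rightarrow>
                        PiCx (shift 1 A') (shift 1 B') (shift 1 c') (shift 1 P') (Succ (Var 0)))"
    using typing_shift[OF wf assms(8)] by (simp add: defs shift_def ren_Arr ren_PiCx)
  have w: "\<Delta> \<turnstile> Var 0 : Wt A' B'" using typing_Var_0[OF wf] by (simp add: defs)
  \<comment> \<open>The level of the generic tree is its own complexity, an open term; the induction
    applies to any term of type \<open>Nat\<close>.\<close>
  let ?n = "App c' (Var 0)"
  have n: "\<Delta> \<turnstile> ?n : Nat" by (rule Arr_elim[OF c' w])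
  obtain d where d: "\<Delta> \<turnstile> d : PiCx A' B' c' P' ?n"
    by (rule PiCx_induct[OF A' B' c' P' \<alpha>' \<beta>' n])
  let ?q = "Pr (Var 0) (Rfl ?n)"
  have W': "\<Delta> \<turnstile> Wt A' B' : Univ i" by (rule Wt_form[OF A' B'])
  have F: "Wt A' B' # \<Delta> \<turnstile> Idt Nat (App (shift 1 c') (Var 0)) (shift 1 ?n) : Univ i"
    by (rule Cx_family[OF ctx_ext[OF typing_wf_ctx[OF W'] W'] c' n])
  \<comment> \<open>Instantiated at the generic tree, both sides of the identity type become
    \<open>?n\<close>, so reflexivity proves it.\<close>
  have r: "\<Delta> \<turnstile> Rfl ?n : (Idt Nat (App (shift 1 c') (Var 0)) (shift 1 ?n))\<langle>Var 0\<rangle>"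
    using Id_intro[OF Nat_form[OF typing_wf_ctx[OF n]] n] by simp
  have q: "\<Delta> \<turnstile> ?q : Cx A' B' c' ?n"
    unfolding Cx_def by (rule Sig_intro[OF W' F w r])
  \<comment> \<open>Keeping the shift of \<open>Wt\<close> folded leaves the type argument of
    \<open>proj1\<close> in the form that \<open>sub_proj1\<close> matches.\<close>
  have dq: "\<Delta> \<turnstile> App d ?q : App P' (proj1 (Wt A' B') ?q)"
    using Pi_elim[OF d[unfolded PiCx_def] q] by (simp add: sub_proj1 sub_Var del: shift_simps(7))
  \<comment> \<open>The computation rule for pairs makes the projection judgementally equal to the
    tree, and congruence carries this to the fibres of \<open>P'\<close>.\<close>
  have "\<Delta> \<turnstile> App P' (proj1 (Wt A' B') ?q) \<doteq> App P' (Var 0) : Univ i"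
    using App_cong[OF eq_refl[OF P'[unfolded Arr_def]] proj1_typing(2)[OF W' F w r]] by simp
  with dq have "\<Delta> \<turnstile> App d ?q : App P' (Var 0)" by (rule conv)
  \<comment> \<open>Abstracting over the generic tree gives \<gamma>.\<close>
  then show ?thesis using Pi_intro[OF W] unfolding defs by blast
qed

end
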